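(* Let $n\ge 3$. The map $F_n:K_{n-1}\to K_{n-1}$ defined by $F_n(h_1,\dots,h_{n-1})=(2a_1,\dots,2a_{n-1})$, where $$2a_i=\Big(\prod_{j=1}^{n-1}h_j\Big)\int_0^\infty\frac{du}{(u^2+h_i^2)\sqrt{\prod_{j=1}^{n-1}(u^2+h_j^2)}},\qquad 1\le i\le n-1,$$ is injective.
   Context: $K_{m}:=\{(x_1,\dots,x_m)\in\mathbb{R}^m: x_1,\dots,x_m>0\}$. *)

theory Defs
  imports "HOL-Analysis.Analysis"
begin

definition K :: "(real ^ 'm) set" where
  "K = {x. \<forall>i. x $ i > 0}"

text \<open>The index type \<open>'m\<close> plays the role of $\{1, \dots, n-1\}$, so that
  \<open>F\<close> at a type with \<open>CARD('m) = n - 1\<close> is the map $F_n$, and its \<open>i\<close>-th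
  component is $2a_i$. The integrand is nonnegative, so the Lebesgue integral over
  \<open>{0..}\<close> agrees with the improper integral; were it divergent, the component would be
  \<open>0\<close>, hence \<open>F h \<in> K\<close> includes convergence.\<close>

definition F :: "real ^ 'm \<Rightarrow> real ^ 'm" where
  "F h = (\<chi> i. (\<Prod>j\<in>UNIV. h $ j) *
     (LBINT u:{0..}. 1 / ((u\<^sup>2 + (h $ i)\<^sup>2) * sqrt (\<Prod>j\<in>UNIV. u\<^sup>2 + (h $ j)\<^sup>2))))"

end

theory Submission
  imports Defs "HOL-Probability.Sinc_Integral"
begin

text \<open>
  Write $F_i(h) = \int_0^\infty \frac{1}{u^2+h_i^2} \prod_j \frac{h_j}{\sqrt{u^2+h_j^2}}\,du$.
  Two properties of this formula make the map injective.

  \<^item> The function $h \mapsto h/\sqrt{u^2+h^2}$ increases, so $F_i$ is nondecreasing in every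
    $h_j$ with $j \neq i$ (\<open>F_mono_off_diagonal\<close>).
  \<^item> Substituting $u \mapsto cu$ shows that $F$ is homogeneous of degree $-1$
    (\<open>F_homogeneous\<close>).

  Suppose that $F(h) = F(g)$, and let $c = g_i/h_i$ be the least of the ratios $g_j/h_j$. Then
  $g \ge c h$ with equality in the $i$-th coordinate, hence
  $F_i(h) = F_i(g) \ge F_i(c h) = F_i(h)/c$. As $F_i(h) > 0$, this forces $c \ge 1$,
  which means $h \le g$ (\<open>le_of_F_eq\<close>). By symmetry $g \le h$ as well.
\<close>

section \<open>The integrand\<close>

text \<open>The prefactor of the integral is distributed over the product under the root, which makes
  the monotonicity in the coordinates visible and bounds the product by 1.\<close>

definition F_integrand :: "real ^ 'm \<Rightarrow> 'm \<Rightarrow> real \<Rightarrow> real" where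
  "F_integrand h i u = (\<Prod>j\<in>UNIV. h $ j / sqrt (u\<^sup>2 + (h $ j)\<^sup>2)) / (u\<^sup>2 + (h $ i)\<^sup>2)"

lemma sqrt_prod: "sqrt (\<Prod>j\<in>A. f j) = (\<Prod>j\<in>A. sqrt (f j))"
  by (induction A rule: infinite_finite_induct) (auto simp: real_sqrt_mult)

lemma F_nth: "F h $ i = (LBINT u:{0..}. F_integrand h i u)"
proof -
  have "F h $ i = (LBINT u:{0..}. (\<Prod>j\<in>UNIV. h $ j) *
      (1 / ((u\<^sup>2 + (h $ i)\<^sup>2) * sqrt (\<Prod>j\<in>UNIV. u\<^sup>2 + (h $ j)\<^sup>2))))"
    unfolding F_def set_integral_mult_right vec_lambda_beta ..
  also have "\<dots> = (LBINT u:{0..}. F_integrand h i u)"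
    unfolding F_integrand_def sqrt_prod prod_dividef by (simp add: mult.commute)
  finally show ?thesis .
qed

lemma F_integrand_pos:
  assumes "h \<in> K"
  shows "F_integrand h i u > 0"
proof -
  have h: "h $ j > 0" for j
    using assms by (simp add: K_def)
  then have "u\<^sup>2 + (h $ j)\<^sup>2 > 0" for j
    by (intro add_nonneg_pos zero_le_power2 zero_less_power)
  with h show ?thesis
    unfolding F_integrand_def by (intro divide_pos_pos prod_pos) auto
qed

lemma F_integrand_le:
  assumes "h \<in> K"
  shows "F_integrand h i u \<le> 1 / (u\<^sup>2 + (h $ i)\<^sup>2)"
proof -
  have "0 \<le> h $ j / sqrt (u\<^sup>2 + (h $ j)\<^sup>2) \<and> h $ j / sqrt (u\<^sup>2 + (h $ j)\<^sup>2) \<le> 1" for j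
  proof -
    have h: "h $ j > 0"
      using assms by (simp add: K_def)
    have le: "h $ j \<le> sqrt (u\<^sup>2 + (h $ j)\<^sup>2)"
      by (intro real_le_rsqrt) simp
    with h have "sqrt (u\<^sup>2 + (h $ j)\<^sup>2) > 0"
      by (rule less_le_trans)
    then have "h $ j / sqrt (u\<^sup>2 + (h $ j)\<^sup>2) \<le> 1"
      using le by (subst pos_divide_le_eq) (assumption, simp only: mult_1_left)
    then show ?thesis
      using h by (intro conjI divide_nonneg_nonneg) auto
  qed
  then have "(\<Prod>j\<in>UNIV. h $ j / sqrt (u\<^sup>2 + (h $ j)\<^sup>2)) \<le> 1"
    by (intro prod_le_1) auto
  then show ?thesis
    unfolding F_integrand_def by (intro divide_right_mono) auto
qed

lemma F_integrand_measurable [measurable]: "F_integrand h i \<in> borel_measurable borel"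
  unfolding F_integrand_def by measurable

lemma integrable_1_div_square_plus_square:
  assumes "c > 0"
  shows "set_integrable lborel {0..} (\<lambda>u. 1 / (u\<^sup>2 + c\<^sup>2 :: real))"
proof -
  have "integrable lborel (\<lambda>u :: real. inverse (1 + u\<^sup>2))"
    using integrable_inverse_1_plus_square by (simp add: set_integrable_def)
  from lborel_integrable_real_affine[OF this, of "1 / c" 0] assms
  have "integrable lborel (\<lambda>u :: real. inverse (1 + (u / c)\<^sup>2))"
    by simp
  then have "integrable lborel (\<lambda>u :: real. inverse (c\<^sup>2) * inverse (1 + (u / c)\<^sup>2))"
    by (rule integrable_mult_right)
  also have "(\<lambda>u :: real. inverse (c\<^sup>2) * inverse (1 + (u / c)\<^sup>2)) = (\<lambda>u. 1 / (u\<^sup>2 + c\<^sup>2))"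
  proof
    fix u :: real
    have "c\<^sup>2 * (1 + (u / c)\<^sup>2) = u\<^sup>2 + c\<^sup>2"
      using assms by (simp add: field_simps power_divide)
    then show "inverse (c\<^sup>2) * inverse (1 + (u / c)\<^sup>2) = 1 / (u\<^sup>2 + c\<^sup>2)"
      by (metis inverse_eq_divide inverse_mult_distrib)
  qed
  finally have "set_integrable lborel UNIV (\<lambda>u :: real. 1 / (u\<^sup>2 + c\<^sup>2))"
    by (simp add: set_integrable_def)
  then show ?thesis
    by (rule set_integrable_subset) auto
qed

lemma set_integrable_F_integrand:
  assumes "h \<in> K"
  shows "set_integrable lborel {0..} (F_integrand h i)"
proof (rule set_integrable_bound)
  show "set_integrable lborel {0..} (\<lambda>u. 1 / (u\<^sup>2 + (h $ i)\<^sup>2))"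
    using assms by (intro integrable_1_div_square_plus_square) (simp add: K_def)
  show "set_borel_measurable lborel {0..} (F_integrand h i)"
    unfolding set_borel_measurable_def by measurable
  show "AE u in lborel. u \<in> {0..} \<longrightarrow> norm (F_integrand h i u) \<le> norm (1 / (u\<^sup>2 + (h $ i)\<^sup>2))"
    using F_integrand_le[OF assms, of i] F_integrand_pos[OF assms, of i]
    by (intro AE_I2) (simp add: less_imp_le)
qed

section \<open>Positivity, monotonicity and homogeneity\<close>

lemma F_nth_pos:
  assumes "h \<in> K"
  shows "F h $ i > 0"
proof -
  let ?f = "\<lambda>u. indicator {0..} u *\<^sub>R F_integrand h i u"
  have int: "integrable lborel ?f"
    using set_integrable_F_integrand[OF assms] by (simp add: set_integrable_def)
  have nonneg: "?f u \<ge> 0" for u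
    using F_integrand_pos[OF assms, of i u] by (simp add: indicator_def)
  have "integral\<^sup>L lborel ?f \<noteq> 0"
  proof
    assume "integral\<^sup>L lborel ?f = 0"
    then have "AE u in lborel. ?f u = 0"
      using integral_nonneg_eq_0_iff_AE[OF int] nonneg by simp
    then have "AE u in lborel. u \<notin> {0..1::real}"
      by eventually_elim
        (use F_integrand_pos[OF assms, of i] in \<open>auto simp: indicator_def less_le split: if_splits\<close>)
    then have "emeasure lborel {0..1::real} = 0"
      by (subst (asm) AE_iff_null_sets[symmetric]) auto
    then show False by simp
  qed
  moreover have "integral\<^sup>L lborel ?f \<ge> 0"
    using nonneg by (intro integral_nonneg_AE) auto
  ultimately show ?thesis
    by (simp add: F_nth set_lebesgue_integral_def)
qed

lemma divide_sqrt_square_plus_mono: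
  fixes x y u :: real
  assumes "0 < x" "x \<le> y"
  shows "x / sqrt (u\<^sup>2 + x\<^sup>2) \<le> y / sqrt (u\<^sup>2 + y\<^sup>2)"
proof -
  have "u\<^sup>2 * x\<^sup>2 \<le> u\<^sup>2 * y\<^sup>2"
    using assms by (intro mult_left_mono power_mono) auto
  then have "(x * sqrt (u\<^sup>2 + y\<^sup>2))\<^sup>2 \<le> (y * sqrt (u\<^sup>2 + x\<^sup>2))\<^sup>2"
    by (simp add: power_mult_distrib algebra_simps)
  then have "x * sqrt (u\<^sup>2 + y\<^sup>2) \<le> y * sqrt (u\<^sup>2 + x\<^sup>2)"
    by (rule power2_le_imp_le) (use assms in simp)
  moreover have "sqrt (u\<^sup>2 + x\<^sup>2) > 0" "sqrt (u\<^sup>2 + y\<^sup>2) > 0"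
    using assms by (auto simp: add_nonneg_pos)
  ultimately show ?thesis
    by (simp add: field_simps)
qed

text \<open>Each factor of the product in the integrand increases with its own coordinate. The \<open>i\<close>-th
  coordinate is kept fixed because $F_i$ decreases in it: by homogeneity $F_i$ decreases along
  the ray through \<open>h\<close>, although all other coordinates contribute an increase there.\<close>

lemma F_mono_off_diagonal:
  assumes "g \<in> K" "h \<in> K" "\<And>j. g $ j \<le> h $ j" "g $ i = h $ i"
  shows "F g $ i \<le> F h $ i"
  unfolding F_nth
proof (rule set_integral_mono)
  fix u :: real
  have "(\<Prod>j\<in>UNIV. g $ j / sqrt (u\<^sup>2 + (g $ j)\<^sup>2)) \<le> (\<Prod>j\<in>UNIV. h $ j / sqrt (u\<^sup>2 + (h $ j)\<^sup>2))"
    using assms by (intro prod_mono) (auto simp: K_def less_imp_le divide_sqrt_square_plus_mono)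
  then show "F_integrand g i u \<le> F_integrand h i u"
    unfolding F_integrand_def \<open>g $ i = h $ i\<close> by (intro divide_right_mono) auto
qed (use assms in \<open>auto intro: set_integrable_F_integrand\<close>)

lemma F_homogeneous:
  assumes "c > 0"
  shows "F (c *\<^sub>R h) $ i = F h $ i / c"
proof -
  have scale: "F_integrand (c *\<^sub>R h) i (c * u) = F_integrand h i u / c\<^sup>2" for u
  proof -
    have "c * x / sqrt ((c * u)\<^sup>2 + (c * x)\<^sup>2) = x / sqrt (u\<^sup>2 + x\<^sup>2)" for x
    proof -
      have "sqrt ((c * u)\<^sup>2 + (c * x)\<^sup>2) = sqrt (c\<^sup>2 * (u\<^sup>2 + x\<^sup>2))"
        by (simp add: power_mult_distrib algebra_simps)
      then show ?thesis
        using assms by (simp add: real_sqrt_mult)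
    qed
    moreover have "(c * u)\<^sup>2 + (c * h $ i)\<^sup>2 = (u\<^sup>2 + (h $ i)\<^sup>2) * c\<^sup>2"
      by (simp add: power_mult_distrib algebra_simps)
    ultimately show ?thesis
      by (simp add: F_integrand_def)
  qed
  have "F (c *\<^sub>R h) $ i = \<bar>c\<bar> *\<^sub>R (LBINT u. indicator {0..} (0 + c * u) *\<^sub>R
      F_integrand (c *\<^sub>R h) i (0 + c * u))"
    unfolding F_nth set_lebesgue_integral_def
    using assms by (intro lborel_integral_real_affine) simp
  also have "\<dots> = c * (LBINT u:{0..}. F_integrand h i u / c\<^sup>2)"
    using assms
    by (simp add: scale set_lebesgue_integral_def indicator_def zero_le_mult_iff)
  also have "\<dots> = F h $ i / c"
    using assms by (simp add: F_nth power2_eq_square)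
  finally show ?thesis .
qed

section \<open>Injectivity\<close>

text \<open>The index \<open>i\<close> minimizing $g_i/h_i$ is the one where the largest multiple of \<open>h\<close> below
  \<open>g\<close> touches \<open>g\<close>; only there can the off-diagonal monotonicity be used to compare the
  two.\<close>

lemma le_of_F_eq:
  assumes "g \<in> K" "h \<in> K" "F g = F h"
  shows "h $ j \<le> g $ j"
proof -
  let ?r = "\<lambda>j. g $ j / h $ j"
  have pos: "g $ k > 0" "h $ k > 0" for k
    using assms by (auto simp: K_def)
  have "Min (range ?r) \<in> range ?r"
    by (intro Min_in) auto
  then obtain i where i: "Min (range ?r) = ?r i"
    by (rule rangeE)
  have min: "?r i \<le> ?r k" for k
    unfolding i[symmetric] by (intro Min_le) auto
  define c where "c = ?r i"
  have "c > 0"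
    using pos[of i] by (simp add: c_def)
  have "c *\<^sub>R h \<in> K"
    using \<open>c > 0\<close> pos by (simp add: K_def)
  moreover have "(c *\<^sub>R h) $ k \<le> g $ k" for k
    using min[of k] pos[of k] by (simp add: c_def pos_le_divide_eq)
  moreover have "(c *\<^sub>R h) $ i = g $ i"
    using pos[of i] by (simp add: c_def)
  ultimately have "F (c *\<^sub>R h) $ i \<le> F g $ i"
    using \<open>g \<in> K\<close> by (intro F_mono_off_diagonal)
  then have "F h $ i / c \<le> F h $ i"
    using \<open>c > 0\<close> \<open>F g = F h\<close> by (simp add: F_homogeneous)
  then have "c \<ge> 1"
    using \<open>c > 0\<close> F_nth_pos[OF \<open>h \<in> K\<close>, of i] by (simp add: pos_divide_le_eq)
  then have "1 \<le> ?r j"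
    using min[of j] by (simp add: c_def)
  then show ?thesis
    using pos[of j] by simp
qed

theorem theorem1p5:
  fixes n :: nat
  assumes "n \<ge> 3" and "CARD('m::finite) = n - 1"
  shows "(F :: real ^ 'm \<Rightarrow> real ^ 'm) \<in> K \<rightarrow> K \<and> inj_on (F :: real ^ 'm \<Rightarrow> real ^ 'm) K"
proof
  show "(F :: real ^ 'm \<Rightarrow> real ^ 'm) \<in> K \<rightarrow> K"
    using F_nth_pos by (auto simp: K_def)
  show "inj_on (F :: real ^ 'm \<Rightarrow> real ^ 'm) K"
    by (intro inj_onI) (simp add: vec_eq_iff order_antisym le_of_F_eq)
qed

end
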